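(* Fix $\hat x, d\in\mathbb S$. Assume that $\mu_0$ is a Gaussian measure satisfying $\mu_0(X)=1$ and that the posterior measures satisfy $\mu_y\ll\mu_0$. Then for every $\tau>0$ there exists $M=M(\tau)>0$ such that for all $y_1,y_2\in\mathbb C$ with $\max\{|y_1|,|y_2|\}<\tau$, $$\rho_H(\mu_{y_1},\mu_{y_2})\le M\,|y_1-y_2|.$$
   Context: Let $\mathbb S=\{x\in\mathbb R^2:|x|=1\}$, let $k>0$ be a fixed wavenumber, $\sigma>0$ a fixed noise level, $z_0\in\mathbb R^2$ a fixed point, and $\alpha\in(0,1]$. Space $X$: $X=C^{2,\alpha}[0,2\pi]$, understood as functions $q$ whose $2\pi$-periodic extension is in $C^{2,\alpha}$ (real-valued), with norm $$\|q\|_X=\|q\|_\infty+\|q'\|_\infty+\|q''\|_\infty+\sup_{\theta\ne\hat\theta\in[0,2\pi]}\frac{|q''(\theta)-q''(\hat\theta)|}{|\theta-\hat\theta|^\alpha}.$$ Obstacle: for $q\in X$, let $\Omega_q\subset\mathbb R^2$ be the bounded, simply connected domain with boundary $\partial\Omega_q=\{z_0+e^{q(\theta)}(\cos\theta,\sin\theta):\theta\in[0,2\pi)\}$. Forward map: for $d\in\mathbb S$, let $u^i(x)=e^{ikx\cdot d}$, and let $u=u^i+u^s$ be the unique total field solving $\Delta u+k^2u=0$ in $\mathbb R^2\setminus\overline{\Omega_q}$, $u=0$ on $\partial\Omega_q$, with $u^s$ satisfying the Sommerfeld radiation condition $\lim_{r\to\infty}\sqrt r\,(\partial u^s/\partial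 r-iku^s)=0$, $r=|x|$. The far-field pattern $u^\infty(\hat x,d;q)$ is defined by $$u^s(x)=\frac{e^{i\pi/4}}{\sqrt{8k\pi}}\frac{e^{ikr}}{\sqrt r}\left\{u^\infty(\hat x,d;q)+O(1/r)\right\},\quad r=|x|\to\infty,\ \hat x=x/|x|,$$ uniformly in $\hat x$. For fixed $\hat x,d\in\mathbb S$, set $\mathcal F(q)=u^\infty(\hat x,d;q)\in\mathbb C$. Weighted norm: $|w|_\sigma=\sigma^{-1}|w|$ for $w\in\mathbb C$. Posterior: the statistical model is $y=\mathcal F(q)+\eta$ with $y\in\mathbb C$, $\eta\sim\mathcal N(0,\sigma^2)$ independent of $q$, and $q$ has prior probability measure $\mu_0$ on $X$ (Gaussian). By Bayes' formula the posterior measure $\mu_y$ of $q$ given $y$ is the probability measure on $X$ with $$\frac{d\mu_y}{d\mu_0}(q)=\frac1{A(y)}\exp\left(-\tfrac12|y-\mathcal F(q)|_\sigma^2\right),\qquad A(y)=\int_X\exp\left(-\tfrac12|y-\mathcal F(q)|_\sigma^2\right)d\mu_0(q).$$ Hellinger distance: for measures $\mu_1,\mu_2$ with common reference measure $\nu$, $$\rho_H(\mu_1,\mu_2)=\left(\frac12\int\left(\sqrt{d\mu_1/d\nu}-\sqrt{d\mu_2/d\nu}\right)^2d\nu\right)^{1/2}.$$ The constant $M$ may depend on $\tau$ and on the fixed data $k,\sigma,z_0,\alpha,\hat x,d,\mu_0$, but not on $y_1,y_2$. *)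

theory Defs
  imports
    "HOL-Probability.Probability"
    "HOL-Complex_Analysis.Complex_Analysis"
    "HOL-Library.Landau_Symbols"
begin

section \<open>The space of periodic Hoelder functions\<close>

text \<open>
  A function on \<open>[0, 2 pi]\<close> whose \<open>2 pi\<close>-periodic extension is of class \<open>C\<^sup>2\<^sup>,\<^sup>\<alpha>\<close> is represented by
  that extension, so that equality in the space is equality of functions on the real line.
\<close>

definition hoelder_space :: "real \<Rightarrow> (real \<Rightarrow> real) set" where
  "hoelder_space \<alpha> = {q.
     (\<forall>\<theta>. q (\<theta> + 2 * pi) = q \<theta>) \<and>
     (\<forall>\<theta>. q field_differentiable at \<theta>) \<and>
     (\<forall>\<theta>. deriv q field_differentiable at \<theta>) \<and>
     (\<exists>C. \<forall>s t. \<bar>deriv (deriv q) s - deriv (deriv q) t\<bar> \<le> C * \<bar>s - t\<bar> powr \<alpha>)}"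

definition hoelder_norm :: "real \<Rightarrow> (real \<Rightarrow> real) \<Rightarrow> real" where
  "hoelder_norm \<alpha> q =
     (SUP \<theta>\<in>{0..2 * pi}. \<bar>q \<theta>\<bar>)
   + (SUP \<theta>\<in>{0..2 * pi}. \<bar>deriv q \<theta>\<bar>)
   + (SUP \<theta>\<in>{0..2 * pi}. \<bar>deriv (deriv q) \<theta>\<bar>)
   + (SUP (s, t)\<in>{(s, t). s \<in> {0..2 * pi} \<and> t \<in> {0..2 * pi} \<and> s \<noteq> t}.
        \<bar>deriv (deriv q) s - deriv (deriv q) t\<bar> / \<bar>s - t\<bar> powr \<alpha>)"

text \<open>
  The locale \<open>Metric_space\<close> asks for symmetry and nonnegativity also outside the carrier, where
  \<open>hoelder_norm\<close> is meaningless; hence the case distinction.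
\<close>

definition hoelder_dist :: "real \<Rightarrow> (real \<Rightarrow> real) \<Rightarrow> (real \<Rightarrow> real) \<Rightarrow> real" where
  "hoelder_dist \<alpha> p q =
     (if p \<in> hoelder_space \<alpha> \<and> q \<in> hoelder_space \<alpha>
      then hoelder_norm \<alpha> (\<lambda>\<theta>. p \<theta> - q \<theta>) else 0)"

definition hoelder_topology :: "real \<Rightarrow> (real \<Rightarrow> real) topology" where
  "hoelder_topology \<alpha> = Metric_space.mtopology (hoelder_space \<alpha>) (hoelder_dist \<alpha>)"

definition hoelder_borel :: "real \<Rightarrow> (real \<Rightarrow> real) measure" where
  "hoelder_borel \<alpha> = sigma (hoelder_space \<alpha>) {U. openin (hoelder_topology \<alpha>) U}"

lemma hoelder_space_add:
  assumes "p \<in> hoelder_space \<alpha>" "q \<in> hoelder_space \<alpha>"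
  shows "(\<lambda>\<theta>. a * p \<theta> + b * q \<theta>) \<in> hoelder_space \<alpha>"
    and "deriv (\<lambda>\<theta>. a * p \<theta> + b * q \<theta>) = (\<lambda>\<theta>. a * deriv p \<theta> + b * deriv q \<theta>)"
    and "deriv (deriv (\<lambda>\<theta>. a * p \<theta> + b * q \<theta>))
           = (\<lambda>\<theta>. a * deriv (deriv p) \<theta> + b * deriv (deriv q) \<theta>)"
proof -
  have dp: "(p has_field_derivative deriv p t) (at t)"
    "(deriv p has_field_derivative deriv (deriv p) t) (at t)"
    and dq: "(q has_field_derivative deriv q t) (at t)"
    "(deriv q has_field_derivative deriv (deriv q) t) (at t)" for t
    using assms by (auto simp: hoelder_space_def field_differentiable_derivI)
  have D1: "((\<lambda>\<theta>. a * p \<theta> + b * q \<theta>) has_field_derivative a * deriv p t + b * deriv q t) (at t)"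
    and D2: "((\<lambda>\<theta>. a * deriv p \<theta> + b * deriv q \<theta>) has_field_derivative
              a * deriv (deriv p) t + b * deriv (deriv q) t) (at t)" for t
    by (intro DERIV_add DERIV_cmult dp dq)+
  show E1: "deriv (\<lambda>\<theta>. a * p \<theta> + b * q \<theta>) = (\<lambda>\<theta>. a * deriv p \<theta> + b * deriv q \<theta>)"
    by (rule ext, rule DERIV_imp_deriv, rule D1)
  show E2: "deriv (deriv (\<lambda>\<theta>. a * p \<theta> + b * q \<theta>))
           = (\<lambda>\<theta>. a * deriv (deriv p) \<theta> + b * deriv (deriv q) \<theta>)"
    unfolding E1 by (rule ext, rule DERIV_imp_deriv, rule D2)
  obtain C where C: "\<And>s t. \<bar>deriv (deriv p) s - deriv (deriv p) t\<bar> \<le> C * \<bar>s - t\<bar> powr \<alpha>"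
    using assms(1) by (auto simp: hoelder_space_def)
  obtain C' where C': "\<And>s t. \<bar>deriv (deriv q) s - deriv (deriv q) t\<bar> \<le> C' * \<bar>s - t\<bar> powr \<alpha>"
    using assms(2) by (auto simp: hoelder_space_def)
  have "\<bar>(a * deriv (deriv p) s + b * deriv (deriv q) s) - (a * deriv (deriv p) t + b * deriv (deriv q) t)\<bar>
          \<le> (\<bar>a\<bar> * C + \<bar>b\<bar> * C') * \<bar>s - t\<bar> powr \<alpha>" for s t
  proof -
    have "\<bar>(a * deriv (deriv p) s + b * deriv (deriv q) s) - (a * deriv (deriv p) t + b * deriv (deriv q) t)\<bar>
          = \<bar>a * (deriv (deriv p) s - deriv (deriv p) t) + b * (deriv (deriv q) s - deriv (deriv q) t)\<bar>"
      by (simp add: algebra_simps)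
    also have "\<dots> \<le> \<bar>a\<bar> * \<bar>deriv (deriv p) s - deriv (deriv p) t\<bar>
                  + \<bar>b\<bar> * \<bar>deriv (deriv q) s - deriv (deriv q) t\<bar>"
      by (metis abs_mult abs_triangle_ineq)
    also have "\<dots> \<le> \<bar>a\<bar> * (C * \<bar>s - t\<bar> powr \<alpha>) + \<bar>b\<bar> * (C' * \<bar>s - t\<bar> powr \<alpha>)"
      by (intro add_mono mult_left_mono C C') auto
    finally show ?thesis by (simp add: algebra_simps)
  qed
  then have "\<exists>C. \<forall>s t. \<bar>deriv (deriv (\<lambda>\<theta>. a * p \<theta> + b * q \<theta>)) s
                      - deriv (deriv (\<lambda>\<theta>. a * p \<theta> + b * q \<theta>)) t\<bar> \<le> C * \<bar>s - t\<bar> powr \<alpha>"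
    unfolding E2 by blast
  moreover have "\<forall>\<theta>. a * p (\<theta> + 2 * pi) + b * q (\<theta> + 2 * pi) = a * p \<theta> + b * q \<theta>"
    using assms by (simp add: hoelder_space_def)
  moreover have "\<forall>\<theta>. (\<lambda>\<theta>. a * p \<theta> + b * q \<theta>) field_differentiable at \<theta>"
    using D1 by (auto simp: field_differentiable_def)
  moreover have "\<forall>\<theta>. deriv (\<lambda>\<theta>. a * p \<theta> + b * q \<theta>) field_differentiable at \<theta>"
    unfolding E1 using D2 by (auto simp: field_differentiable_def)
  ultimately show "(\<lambda>\<theta>. a * p \<theta> + b * q \<theta>) \<in> hoelder_space \<alpha>"
    unfolding hoelder_space_def by blast
qed

lemma hoelder_bdd:
  assumes "0 < \<alpha>" "q \<in> hoelder_space \<alpha>"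
  shows "bdd_above ((\<lambda>\<theta>. \<bar>q \<theta>\<bar>) ` {0..2 * pi})"
    and "bdd_above ((\<lambda>\<theta>. \<bar>deriv q \<theta>\<bar>) ` {0..2 * pi})"
    and "bdd_above ((\<lambda>\<theta>. \<bar>deriv (deriv q) \<theta>\<bar>) ` {0..2 * pi})"
    and "bdd_above ((\<lambda>(s, t). \<bar>deriv (deriv q) s - deriv (deriv q) t\<bar> / \<bar>s - t\<bar> powr \<alpha>) `
           {(s, t). s \<in> {0..2 * pi} \<and> t \<in> {0..2 * pi} \<and> s \<noteq> t})"
proof -
  have bdd: "bdd_above ((\<lambda>\<theta>. \<bar>f \<theta>\<bar>) ` {0..2 * pi})" if "\<And>t. f field_differentiable at t"
    for f :: "real \<Rightarrow> real"
  proof -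
    have "continuous_on {0..2 * pi} (\<lambda>\<theta>. \<bar>f \<theta>\<bar>)"
      by (intro continuous_intros continuous_at_imp_continuous_on ballI
          field_differentiable_imp_continuous_at that)
    then show ?thesis
      by (intro bounded_imp_bdd_above compact_imp_bounded compact_continuous_image) auto
  qed
  show "bdd_above ((\<lambda>\<theta>. \<bar>q \<theta>\<bar>) ` {0..2 * pi})" "bdd_above ((\<lambda>\<theta>. \<bar>deriv q \<theta>\<bar>) ` {0..2 * pi})"
    by (rule bdd; use assms in \<open>simp add: hoelder_space_def\<close>)+
  obtain C where C: "\<And>s t. \<bar>deriv (deriv q) s - deriv (deriv q) t\<bar> \<le> C * \<bar>s - t\<bar> powr \<alpha>"
    using assms(2) by (auto simp: hoelder_space_def)
  show "bdd_above ((\<lambda>(s, t). \<bar>deriv (deriv q) s - deriv (deriv q) t\<bar> / \<bar>s - t\<bar> powr \<alpha>) `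
           {(s, t). s \<in> {0..2 * pi} \<and> t \<in> {0..2 * pi} \<and> s \<noteq> t})"
    by (rule bdd_aboveI2[of _ _ C]) (use C in \<open>auto simp: divide_le_eq\<close>)
  have "C * \<bar>0 - 1\<bar> powr \<alpha> \<ge> 0"
    using C[of 0 1] by linarith
  then have C0: "0 \<le> C" by simp
  have "\<bar>deriv (deriv q) t\<bar> \<le> \<bar>deriv (deriv q) 0\<bar> + C * (2 * pi) powr \<alpha>" if "t \<in> {0..2 * pi}" for t
  proof -
    have "C * \<bar>t - 0\<bar> powr \<alpha> \<le> C * (2 * pi) powr \<alpha>"
      using that assms(1) C0 by (intro mult_left_mono powr_mono2) auto
    then show ?thesis using C[of t 0] by linarith
  qed
  then show "bdd_above ((\<lambda>\<theta>. \<bar>deriv (deriv q) \<theta>\<bar>) ` {0..2 * pi})"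
    by (intro bdd_aboveI2)
qed

lemma Metric_space_hoelder:
  assumes \<alpha>: "0 < \<alpha>"
  shows "Metric_space (hoelder_space \<alpha>) (hoelder_dist \<alpha>)"
proof -
  let ?X = "hoelder_space \<alpha>" and ?I = "{0..2 * pi}"
  let ?J = "{(s::real, t::real). s \<in> ?I \<and> t \<in> ?I \<and> s \<noteq> t}"
  let ?Q = "\<lambda>q (s, t). \<bar>deriv (deriv q) s - deriv (deriv q) t\<bar> / \<bar>s - t\<bar> powr \<alpha>"
  have J: "?J \<noteq> {}"
  proof -
    have "(0, 2 * pi) \<in> ?J" by simp
    then show ?thesis by blast
  qed
  have I: "?I \<noteq> {}" by simp
  have I0: "0 \<in> ?I" by simp
  have bounds: "0 \<le> hoelder_norm \<alpha> q" "t \<in> ?I \<Longrightarrow> \<bar>q t\<bar> \<le> hoelder_norm \<alpha> q"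
    if q: "q \<in> ?X" for q t
  proof -
    note b = hoelder_bdd[OF \<alpha> q]
    have 1: "0 \<le> (SUP \<theta>\<in>?I. \<bar>q \<theta>\<bar>)" "0 \<le> (SUP \<theta>\<in>?I. \<bar>deriv q \<theta>\<bar>)"
      "0 \<le> (SUP \<theta>\<in>?I. \<bar>deriv (deriv q) \<theta>\<bar>)"
      using b(1-3) I0 by (auto intro: cSUP_upper2[where x=0])
    have 2: "0 \<le> (SUP z\<in>?J. ?Q q z)"
      by (rule cSUP_upper2[where x="(0, 2 * pi)"]) (use b(4) in auto)
    show "0 \<le> hoelder_norm \<alpha> q"
      unfolding hoelder_norm_def using 1 2 by simp
    assume "t \<in> ?I"
    then have "\<bar>q t\<bar> \<le> (SUP \<theta>\<in>?I. \<bar>q \<theta>\<bar>)"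
      using b(1) by (intro cSUP_upper)
    then show "\<bar>q t\<bar> \<le> hoelder_norm \<alpha> q"
      unfolding hoelder_norm_def using 1 2 by simp
  qed
  have diff: "(\<lambda>\<theta>. p \<theta> - q \<theta>) \<in> ?X"
    "deriv (\<lambda>\<theta>. p \<theta> - q \<theta>) = (\<lambda>\<theta>. deriv p \<theta> - deriv q \<theta>)"
    "deriv (deriv (\<lambda>\<theta>. p \<theta> - q \<theta>)) = (\<lambda>\<theta>. deriv (deriv p) \<theta> - deriv (deriv q) \<theta>)"
    if "p \<in> ?X" "q \<in> ?X" for p q
    using hoelder_space_add[OF that, of 1 "-1"] by simp_all
  show ?thesis
  proof
    show "0 \<le> hoelder_dist \<alpha> p q" for p q
      using bounds(1) diff(1) by (simp add: hoelder_dist_def)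
    show "hoelder_dist \<alpha> p q = hoelder_dist \<alpha> q p" for p q
      using diff(2,3)[of p q] diff(2,3)[of q p]
      by (auto simp: hoelder_dist_def hoelder_norm_def abs_minus_commute add.commute algebra_simps
          intro!: arg_cong2[where f="(+)"] SUP_cong arg_cong2[where f="(/)"])
    show "hoelder_dist \<alpha> p q = 0 \<longleftrightarrow> p = q" if pq: "p \<in> ?X" "q \<in> ?X" for p q
    proof
      assume "hoelder_dist \<alpha> p q = 0"
      then have "hoelder_norm \<alpha> (\<lambda>\<theta>. p \<theta> - q \<theta>) = 0"
        using pq by (simp add: hoelder_dist_def)
      then have 0: "p t = q t" if "t \<in> ?I" for t
        using bounds(2)[OF diff(1)[OF pq] that] by simp
      have per: "f t = f (t - 2 * pi * of_int n)" if "f \<in> ?X" for f t n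
      proof -
        interpret periodic_fun_simple f "2 * pi"
          by standard (use that in \<open>simp add: hoelder_space_def\<close>)
        show ?thesis using minus_of_int[of t n] by (simp add: mult.commute)
      qed
      show "p = q"
      proof
        fix t
        define n where "n = \<lfloor>t / (2 * pi)\<rfloor>"
        have "of_int n \<le> t / (2 * pi)" "t / (2 * pi) < of_int n + 1"
          unfolding n_def by linarith+
        then have "t - 2 * pi * of_int n \<in> ?I"
          by (auto simp: field_simps)
        then show "p t = q t"
          using 0 per[OF pq(1), of t n] per[OF pq(2), of t n] by simp
      qed
    next
      assume "p = q"
      moreover have "(SUP z\<in>?J. ?Q (\<lambda>_. 0) z) = (SUP z\<in>?J. 0)"
        by (rule SUP_cong) auto
      ultimately show "hoelder_dist \<alpha> p q = 0"
        using J by (simp add: hoelder_dist_def hoelder_norm_def)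
    qed
    show "hoelder_dist \<alpha> p r \<le> hoelder_dist \<alpha> p q + hoelder_dist \<alpha> q r"
      if "p \<in> ?X" "q \<in> ?X" "r \<in> ?X" for p q r
    proof -
      let ?f = "\<lambda>\<theta>. p \<theta> - q \<theta>" and ?g = "\<lambda>\<theta>. q \<theta> - r \<theta>" and ?h = "\<lambda>\<theta>. p \<theta> - r \<theta>"
      note bf = hoelder_bdd[OF \<alpha> diff(1)[OF that(1,2)]]
      note bg = hoelder_bdd[OF \<alpha> diff(1)[OF that(2,3)]]
      have sub: "(SUP x\<in>A. w x) \<le> (SUP x\<in>A. u x) + (SUP x\<in>A. v x)"
        if "A \<noteq> {}" "bdd_above (u ` A)" "bdd_above (v ` A)" "\<And>x. x \<in> A \<Longrightarrow> w x \<le> u x + v x"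
        for A :: "'z set" and u v w :: "'z \<Rightarrow> real"
      proof (rule cSUP_least[OF that(1)])
        fix x assume x: "x \<in> A"
        show "w x \<le> (SUP x\<in>A. u x) + (SUP x\<in>A. v x)"
          using that(4)[OF x] cSUP_upper[OF x that(2)] cSUP_upper[OF x that(3)] by linarith
      qed
      have h: "deriv ?h = (\<lambda>t. deriv ?f t + deriv ?g t)"
        unfolding diff(2)[OF that(1,2)] diff(2)[OF that(2,3)] diff(2)[OF that(1,3)] by simp
      have h': "deriv (deriv ?h) = (\<lambda>t. deriv (deriv ?f) t + deriv (deriv ?g) t)"
        unfolding diff(3)[OF that(1,2)] diff(3)[OF that(2,3)] diff(3)[OF that(1,3)] by simp
      have 1: "(SUP t\<in>?I. \<bar>?h t\<bar>) \<le> (SUP t\<in>?I. \<bar>?f t\<bar>) + (SUP t\<in>?I. \<bar>?g t\<bar>)"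
        by (rule sub[OF I bf(1) bg(1)]) linarith
      have 2: "(SUP t\<in>?I. \<bar>deriv ?h t\<bar>) \<le> (SUP t\<in>?I. \<bar>deriv ?f t\<bar>) + (SUP t\<in>?I. \<bar>deriv ?g t\<bar>)"
        unfolding h by (rule sub[OF I bf(2) bg(2)]) linarith
      have 3: "(SUP t\<in>?I. \<bar>deriv (deriv ?h) t\<bar>)
                 \<le> (SUP t\<in>?I. \<bar>deriv (deriv ?f) t\<bar>) + (SUP t\<in>?I. \<bar>deriv (deriv ?g) t\<bar>)"
        unfolding h' by (rule sub[OF I bf(3) bg(3)]) linarith
      have 4: "(SUP z\<in>?J. ?Q ?h z) \<le> (SUP z\<in>?J. ?Q ?f z) + (SUP z\<in>?J. ?Q ?g z)"
        unfolding h'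
        by (rule sub[OF J bf(4) bg(4)])
          (auto simp: add_divide_distrib[symmetric] intro!: divide_right_mono)
      show ?thesis
        using that 1 2 3 4 unfolding hoelder_dist_def hoelder_norm_def by simp
    qed
  qed
qed


section \<open>The obstacle\<close>

definition obstacle_boundary :: "real^2 \<Rightarrow> (real \<Rightarrow> real) \<Rightarrow> (real^2) set" where
  "obstacle_boundary z0 q = {z0 + exp (q \<theta>) *\<^sub>R vector [cos \<theta>, sin \<theta>] | \<theta>. 0 \<le> \<theta> \<and> \<theta> < 2 * pi}"

definition obstacle :: "real^2 \<Rightarrow> (real \<Rightarrow> real) \<Rightarrow> (real^2) set" where
  "obstacle z0 q = inside (obstacle_boundary z0 q)"

lemma inside_linear_image:
  fixes f :: "'a::euclidean_space \<Rightarrow> 'b::euclidean_space"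
  assumes f: "linear f" "bij f"
  shows "inside (f ` S) = f ` inside S"
proof -
  define g where "g = inv f"
  have fg: "f (g y) = y" "g (f x) = x" for x y
    using f(2) by (simp_all add: g_def bij_is_surj surj_f_inv_f bij_is_inj)
  have lg: "linear g"
  proof (rule linearI)
    show "g (x + y) = g x + g y" for x y
      using arg_cong[OF linear_add[OF f(1), of "g x" "g y"], of g] by (simp only: fg)
    show "g (r *\<^sub>R x) = r *\<^sub>R g x" for r x
      using arg_cong[OF linear_scale[OF f(1), of r "g x"], of g] by (simp only: fg)
  qed
  have cc: "h ` connected_component_set (- T) x \<subseteq> connected_component_set (- h ` T) (h x)"
    if h: "linear h" "inj h" for h :: "'c::euclidean_space \<Rightarrow> 'd::euclidean_space" and T x
  proof (cases "x \<in> T")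
    case True
    then have "connected_component_set (- T) x = {}" by (simp add: connected_component_eq_empty del: Collect_empty_eq)
    then show ?thesis by (simp only: image_empty empty_subsetI)
  next
    case False
    show ?thesis
    proof (rule connected_component_maximal)
      show "h x \<in> h ` connected_component_set (- T) x"
        using False by (simp add: connected_component_refl_eq)
      show "connected (h ` connected_component_set (- T) x)"
        by (intro connected_continuous_image linear_continuous_on connected_connected_component)
          (use h(1) in \<open>simp add: linear_conv_bounded_linear\<close>)
      show "h ` connected_component_set (- T) x \<subseteq> - h ` T"
        using connected_component_subset[of "- T" x] h(2) by (auto dest: injD)
    qed
  qed
  have bl: "bounded (h ` A)" if "linear h" "bounded A"
    for h :: "'c::euclidean_space \<Rightarrow> 'd::euclidean_space" and A
    using that by (intro bounded_linear_image) (simp_all add: linear_conv_bounded_linear)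
  have gf: "g ` f ` S = S"
    by (simp add: image_image fg)
  have inj: "inj f" "inj g"
    using f(2) fg by (auto simp: bij_is_inj intro: inj_on_inverseI)
  have eq: "f x \<in> inside (f ` S) \<longleftrightarrow> x \<in> inside S" for x
  proof -
    have "bounded (connected_component_set (- f ` S) (f x)) \<longleftrightarrow>
          bounded (connected_component_set (- S) x)"
    proof
      assume "bounded (connected_component_set (- f ` S) (f x))"
      then have "bounded (g ` f ` connected_component_set (- S) x)"
        by (intro bl[OF lg] bounded_subset[OF _ cc[OF f(1) inj(1)]])
      then show "bounded (connected_component_set (- S) x)"
        by (simp add: image_image fg)
    next
      assume "bounded (connected_component_set (- S) x)"
      moreover have "g ` connected_component_set (- f ` S) (f x) \<subseteq> connected_component_set (- S) x"
        using cc[OF lg inj(2), of "f ` S" "f x"] by (simp add: gf fg)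
      ultimately have "bounded (f ` g ` connected_component_set (- f ` S) (f x))"
        by (intro bl[OF f(1)]) (rule bounded_subset)
      then show "bounded (connected_component_set (- f ` S) (f x))"
        by (simp add: image_image fg)
    qed
    then show ?thesis
      using inj(1) by (auto simp: inside_def dest: injD)
  qed
  show ?thesis
  proof (intro set_eqI iffI)
    fix y assume "y \<in> inside (f ` S)"
    then have "g y \<in> inside S" using eq[of "g y"] by (simp add: fg)
    then have "f (g y) \<in> f ` inside S" by (rule imageI)
    then show "y \<in> f ` inside S" by (simp only: fg)
  qed (use eq in auto)
qed

text \<open>
  The curve is a Jordan curve, so that \<open>obstacle z0 q\<close> is the bounded simply connected domain
  with boundary \<open>obstacle_boundary z0 q\<close>.
\<close>

lemma obstacle_domain:
  assumes q: "q \<in> hoelder_space \<alpha>"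
  shows "open (obstacle z0 q)" "connected (obstacle z0 q)" "obstacle z0 q \<noteq> {}"
    "bounded (obstacle z0 q)" "simply_connected (obstacle z0 q)"
    "frontier (obstacle z0 q) = obstacle_boundary z0 q"
proof -
  define f :: "complex \<Rightarrow> real^2" where "f = (\<lambda>z. vector [Re z, Im z])"
  have lf: "linear f"
    by (rule linearI) (simp_all add: f_def vec_eq_iff forall_2)
  have bf: "bij f"
  proof (rule bijI)
    show "inj f" by (rule injI) (simp add: f_def vec_eq_iff forall_2 complex_eq_iff)
    have "f (Complex (y$1) (y$2)) = y" for y
      by (simp add: f_def vec_eq_iff forall_2)
    then show "surj f" by (intro surjI[of f "\<lambda>y::real^2. Complex (y$1) (y$2)"])
  qed
  define c where "c = Complex (z0$1) (z0$2)"
  define g where "g = (\<lambda>t. c + exp (of_real (q (2 * pi * t)) + \<i> * of_real (2 * pi * t)))"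
  have per: "q (2 * pi) = q 0"
    using q unfolding hoelder_space_def by (metis (mono_tags, lifting) add_0 mem_Collect_eq)
  have cq: "continuous_on A q" for A
    using q by (auto simp: hoelder_space_def intro!: continuous_at_imp_continuous_on
        field_differentiable_imp_continuous_at)
  have pg: "path g"
    unfolding path_def g_def
    by (intro continuous_intros continuous_on_compose2[OF cq[of UNIV]]) auto
  have "s = t \<or> s = 0 \<and> t = 1 \<or> s = 1 \<and> t = 0"
    if st: "s \<in> {0..1}" "t \<in> {0..1}" and eq: "g s = g t" for s t
  proof -
    have "exp (of_real (q (2 * pi * s)) + \<i> * of_real (2 * pi * s))
        = exp (of_real (q (2 * pi * t)) + \<i> * of_real (2 * pi * t))"
      using eq by (simp add: g_def)
    then obtain n :: int where n: "of_real (q (2 * pi * s)) + \<i> * of_real (2 * pi * s)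
        = of_real (q (2 * pi * t)) + \<i> * of_real (2 * pi * t) + of_int (2 * n) * (of_real pi * \<i>)"
      by (auto simp: exp_eq mult.assoc)
    then have "Im (of_real (q (2 * pi * s)) + \<i> * of_real (2 * pi * s))
        = Im (of_real (q (2 * pi * t)) + \<i> * of_real (2 * pi * t) + of_int (2 * n) * (of_real pi * \<i>))"
      by (rule arg_cong)
    then have "2 * pi * s = 2 * pi * t + 2 * pi * of_int n"
      by simp
    then have "2 * pi * s = 2 * pi * (t + of_int n)"
      by (simp add: distrib_left)
    then have sn: "s = t + of_int n" by simp
    have "n = 0 \<or> n = 1 \<or> n = -1"
    proof -
      have "real_of_int n \<le> 1" "-1 \<le> real_of_int n" using sn st by auto
      then show ?thesis by linarith
    qed
    then show ?thesis using sn st by auto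
  qed
  then have sg: "simple_path g"
    using pg by (auto simp: simple_path_def loop_free_def)
  have loop: "pathfinish g = pathstart g"
    by (simp add: g_def pathfinish_def pathstart_def per exp_add complex_eq_iff Re_exp Im_exp)
  have "path_image g = {g t |t. 0 \<le> t \<and> t < 1}"
  proof -
    have "g 1 = g 0" using loop by (simp add: pathfinish_def pathstart_def)
    then have "g t \<in> {g t |t. 0 \<le> t \<and> t < 1}" if "0 \<le> t" "t \<le> 1" for t
      using that by (cases "t = 1") (auto intro: exI[of _ 0] exI[of _ t])
    then show ?thesis by (fastforce simp: path_image_def)
  qed
  also have "\<dots> = {c + exp (of_real (q \<theta>) + \<i> * of_real \<theta>) |\<theta>. 0 \<le> \<theta> \<and> \<theta> < 2 * pi}"
  proof (intro set_eqI iffI; clarify)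
    fix t :: real assume "0 \<le> t" "t < 1"
    then show "\<exists>\<theta>. g t = c + exp (of_real (q \<theta>) + \<i> * of_real \<theta>) \<and> 0 \<le> \<theta> \<and> \<theta> < 2 * pi"
      by (intro exI[of _ "2 * pi * t"]) (simp add: g_def)
  next
    fix \<theta> :: real assume "0 \<le> \<theta>" "\<theta> < 2 * pi"
    then show "\<exists>t. c + exp (of_real (q \<theta>) + \<i> * of_real \<theta>) = g t \<and> 0 \<le> t \<and> t < 1"
      by (intro exI[of _ "\<theta>/(2 * pi)"]) (simp add: g_def)
  qed
  finally have pig: "path_image g = \<dots>" .
  have pt: "f (c + exp (of_real r + \<i> * of_real \<theta>)) = z0 + exp r *\<^sub>R vector [cos \<theta>, sin \<theta>]" for r \<theta>
    by (simp add: f_def c_def vec_eq_iff forall_2 Re_exp Im_exp)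
  have im: "f ` path_image g = obstacle_boundary z0 q"
    unfolding pig obstacle_boundary_def pt[symmetric] by blast
  have ob: "obstacle z0 q = f ` inside (path_image g)"
    unfolding obstacle_def im[symmetric] by (rule inside_linear_image[OF lf bf])
  note J = Jordan_inside_outside[OF sg loop]
  show "open (obstacle z0 q)"
    unfolding ob using J lf bf by (auto intro: open_bijective_linear_image_eq[THEN iffD2])
  show "connected (obstacle z0 q)"
    unfolding ob using J lf
    by (intro connected_continuous_image linear_continuous_on)
      (auto simp: linear_conv_bounded_linear)
  show "obstacle z0 q \<noteq> {}" unfolding ob using J by auto
  show "bounded (obstacle z0 q)"
    unfolding ob using J lf
    by (intro bounded_linear_image) (auto simp: linear_conv_bounded_linear)
  show "simply_connected (obstacle z0 q)"
    unfolding ob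
    by (rule homeomorphic_simply_connected[OF linear_homeomorphic_image[OF lf bij_is_inj[OF bf]]])
      (rule simply_connected_inside_simple_path[OF sg])
  show "frontier (obstacle z0 q) = obstacle_boundary z0 q"
    unfolding ob im[symmetric] using J lf bf
    by (simp add: frontier_def closure_injective_linear_image[symmetric]
        interior_bijective_linear_image image_set_diff[symmetric] bij_is_inj)
qed


section \<open>The scattering problem\<close>

definition C1_on :: "'a::euclidean_space set \<Rightarrow> ('a \<Rightarrow> complex) \<Rightarrow> bool" where
  "C1_on S f \<longleftrightarrow> (\<forall>x\<in>S. f differentiable (at x)) \<and>
     (\<forall>b\<in>Basis. continuous_on S (\<lambda>x. frechet_derivative f (at x) b))"

definition C2_on :: "'a::euclidean_space set \<Rightarrow> ('a \<Rightarrow> complex) \<Rightarrow> bool" where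
  "C2_on S f \<longleftrightarrow> C1_on S f \<and> (\<forall>b\<in>Basis. C1_on S (\<lambda>x. frechet_derivative f (at x) b))"

definition laplacian :: "('a::euclidean_space \<Rightarrow> complex) \<Rightarrow> 'a \<Rightarrow> complex" where
  "laplacian f x = (\<Sum>b\<in>Basis. frechet_derivative (\<lambda>y. frechet_derivative f (at y) b) (at x) b)"

definition radial_derivative :: "('a::euclidean_space \<Rightarrow> complex) \<Rightarrow> 'a \<Rightarrow> complex" where
  "radial_derivative f x = frechet_derivative f (at x) (x /\<^sub>R norm x)"

text \<open>Limits along \<^const>\<open>at_infinity\<close> are uniform in the direction \<open>x / |x|\<close>.\<close>

definition sommerfeld :: "real \<Rightarrow> (real^2 \<Rightarrow> complex) \<Rightarrow> bool" where
  "sommerfeld k us \<longleftrightarrow>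
     ((\<lambda>x. of_real (sqrt (norm x)) * (radial_derivative us x - \<i> * of_real k * us x))
        \<longlongrightarrow> 0) at_infinity"

definition incident_field :: "real \<Rightarrow> real^2 \<Rightarrow> real^2 \<Rightarrow> complex" where
  "incident_field k d x = exp (\<i> * of_real k * of_real (x \<bullet> d))"

definition is_total_field ::
  "real \<Rightarrow> real^2 \<Rightarrow> (real \<Rightarrow> real) \<Rightarrow> real^2 \<Rightarrow> (real^2 \<Rightarrow> complex) \<Rightarrow> bool" where
  "is_total_field k z0 q d u \<longleftrightarrow>
     C2_on (- closure (obstacle z0 q)) u \<and>
     continuous_on (- obstacle z0 q) u \<and>
     (\<forall>x \<in> - closure (obstacle z0 q). laplacian u x + of_real (k\<^sup>2) * u x = 0) \<and>
     (\<forall>x \<in> obstacle_boundary z0 q. u x = 0) \<and>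
     sommerfeld k (\<lambda>x. u x - incident_field k d x)"

definition is_far_field_pattern ::
  "real \<Rightarrow> (real^2 \<Rightarrow> complex) \<Rightarrow> (real^2 \<Rightarrow> complex) \<Rightarrow> bool" where
  "is_far_field_pattern k us uinf \<longleftrightarrow>
     (\<exists>h. h \<in> O[at_infinity](\<lambda>x. of_real (1 / norm x)) \<and>
       (\<forall>\<^sub>F x in at_infinity.
          us x = exp (\<i> * of_real pi / 4) / of_real (sqrt (8 * k * pi))
               * (exp (\<i> * of_real k * of_real (norm x)) / of_real (sqrt (norm x)))
               * (uinf (x /\<^sub>R norm x) + h x)))"

text \<open>
  The total field is unique only up to its (irrelevant) values inside the obstacle, and a far-field
  pattern only up to its values off the unit circle; hence the definite description is put on the
  value at \<open>xhat\<close>.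
\<close>

definition far_field :: "real \<Rightarrow> real^2 \<Rightarrow> real^2 \<Rightarrow> real^2 \<Rightarrow> (real \<Rightarrow> real) \<Rightarrow> complex" where
  "far_field k z0 xhat d q =
     (THE w. \<exists>u uinf. is_total_field k z0 q d u \<and>
        is_far_field_pattern k (\<lambda>x. u x - incident_field k d x) uinf \<and> w = uinf xhat)"


section \<open>Gaussian prior, posterior, Hellinger distance\<close>

definition bounded_functional :: "real \<Rightarrow> ((real \<Rightarrow> real) \<Rightarrow> real) \<Rightarrow> bool" where
  "bounded_functional \<alpha> L \<longleftrightarrow>
     (\<forall>p\<in>hoelder_space \<alpha>. \<forall>q\<in>hoelder_space \<alpha>. \<forall>a b.
        L (\<lambda>\<theta>. a * p \<theta> + b * q \<theta>) = a * L p + b * L q) \<and>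
     (\<exists>C. \<forall>q\<in>hoelder_space \<alpha>. \<bar>L q\<bar> \<le> C * hoelder_norm \<alpha> q)"

text \<open>Point masses count as (degenerate) normal distributions.\<close>

definition normal_distribution :: "real measure \<Rightarrow> bool" where
  "normal_distribution \<nu> \<longleftrightarrow>
     (\<exists>m. \<nu> = return borel m) \<or>
     (\<exists>m s. 0 < s \<and> \<nu> = density lborel (\<lambda>x. ennreal (normal_density m s x)))"

definition gaussian_measure :: "real \<Rightarrow> (real \<Rightarrow> real) measure \<Rightarrow> bool" where
  "gaussian_measure \<alpha> \<mu> \<longleftrightarrow>
     prob_space \<mu> \<and> space \<mu> = hoelder_space \<alpha> \<and> sets \<mu> = sets (hoelder_borel \<alpha>) \<and>
     (\<forall>L. bounded_functional \<alpha> L \<longrightarrow> normal_distribution (distr \<mu> borel L))"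

definition noise_norm :: "real \<Rightarrow> complex \<Rightarrow> real" where
  "noise_norm \<sigma> w = norm w / \<sigma>"

definition likelihood :: "real \<Rightarrow> ('q \<Rightarrow> complex) \<Rightarrow> complex \<Rightarrow> 'q \<Rightarrow> real" where
  "likelihood \<sigma> F y q = exp (- (1/2) * (noise_norm \<sigma> (y - F q))\<^sup>2)"

definition evidence :: "real \<Rightarrow> ('q \<Rightarrow> complex) \<Rightarrow> 'q measure \<Rightarrow> complex \<Rightarrow> real" where
  "evidence \<sigma> F \<mu>0 y = (\<integral>q. likelihood \<sigma> F y q \<partial>\<mu>0)"

definition is_posterior ::
  "real \<Rightarrow> ('q \<Rightarrow> complex) \<Rightarrow> 'q measure \<Rightarrow> complex \<Rightarrow> 'q measure \<Rightarrow> bool" where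
  "is_posterior \<sigma> F \<mu>0 y \<mu> \<longleftrightarrow>
     prob_space \<mu> \<and> sets \<mu> = sets \<mu>0 \<and>
     (AE q in \<mu>0. RN_deriv \<mu>0 \<mu> q = ennreal (likelihood \<sigma> F y q / evidence \<sigma> F \<mu>0 y))"

definition hellinger_dist :: "'q measure \<Rightarrow> 'q measure \<Rightarrow> 'q measure \<Rightarrow> real" where
  "hellinger_dist \<nu> \<mu>1 \<mu>2 =
     sqrt (1/2 * (\<integral>q. (sqrt (enn2real (RN_deriv \<nu> \<mu>1 q))
                      - sqrt (enn2real (RN_deriv \<nu> \<mu>2 q)))\<^sup>2 \<partial>\<nu>))"

end

theory Submission
  imports Defs
begin

text \<open>
  Write \<open>w\<close> for the value of the forward map. The square root \<open>exp (- |y - w|\<^sup>2 / (4 \<sigma>\<^sup>2))\<close> of the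
  likelihood is Lipschitz in \<open>y\<close> with a constant that does not depend on \<open>w\<close>, hence so is the
  evidence. As \<open>|y - w|\<^sup>2 \<le> 2 |y|\<^sup>2 + 2 |w|\<^sup>2\<close>, the Cauchy-Schwarz inequality bounds the evidence at \<open>y\<close>
  from below by \<open>exp (- \<tau>\<^sup>2 / \<sigma>\<^sup>2)\<close> times the square of the evidence at \<open>0\<close>. The latter is nonzero, for
  otherwise the Radon-Nikodym derivative of the posterior would vanish almost everywhere. Thus the
  square roots of the posterior densities are Lipschitz in \<open>y\<close>, uniformly in \<open>w\<close>.
\<close>

text \<open>Mean value bound: the derivative \<open>- 2 * t * exp (- t\<^sup>2)\<close> has modulus
  at most 1, because
  \<open>2 * \<bar>t\<bar> \<le> 1 + t\<^sup>2 \<le> exp (t\<^sup>2)\<close>.\<close>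

lemma exp_neg_square_lipschitz: "\<bar>exp (- x\<^sup>2) - exp (- y\<^sup>2)\<bar> \<le> \<bar>x - y\<bar>" for x y :: real
proof -
  have "norm (exp (- x\<^sup>2) - exp (- y\<^sup>2)) \<le> 1 * norm (x - y)"
  proof (rule field_differentiable_bound[where S = UNIV])
    show "((\<lambda>x. exp (- x\<^sup>2)) has_field_derivative - 2 * t * exp (- t\<^sup>2)) (at t within UNIV)"
      for t :: real
      by (auto intro!: derivative_eq_intros)
    show "norm (- 2 * t * exp (- t\<^sup>2)) \<le> 1" for t :: real
    proof -
      have "2 * \<bar>t\<bar> \<le> 1 + t\<^sup>2"
        using zero_le_power2[of "\<bar>t\<bar> - 1"] by (simp add: power2_diff)
      also have "\<dots> \<le> exp (t\<^sup>2)" by simp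
      finally show ?thesis by (simp add: abs_mult exp_minus field_simps)
    qed
  qed auto
  then show ?thesis by simp
qed

text \<open>Brings the root to the form \<open>exp (- x\<^sup>2)\<close> with
  \<open>x = norm (y - F q) / (2 * \<sigma>)\<close>, to which the preceding estimate
  applies.\<close>

lemma sqrt_likelihood:
  assumes "0 < \<sigma>"
  shows "sqrt (likelihood \<sigma> F y q) = exp (- (norm (y - F q) / (2 * \<sigma>))\<^sup>2)"
proof (rule real_sqrt_unique)
  show "(exp (- (norm (y - F q) / (2 * \<sigma>))\<^sup>2))\<^sup>2 = likelihood \<sigma> F y q"
    unfolding likelihood_def noise_norm_def exp_double[symmetric]
    by (simp add: power_divide power_mult_distrib)
qed simp

text \<open>The reverse triangle inequality cancels \<open>F q\<close>, which makes the constant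
  uniform in \<open>q\<close>.\<close>

lemma sqrt_likelihood_lipschitz:
  assumes "0 < \<sigma>"
  shows "\<bar>sqrt (likelihood \<sigma> F y q) - sqrt (likelihood \<sigma> F z q)\<bar> \<le> norm (y - z) / (2 * \<sigma>)"
proof -
  have "\<bar>sqrt (likelihood \<sigma> F y q) - sqrt (likelihood \<sigma> F z q)\<bar>
      \<le> \<bar>norm (y - F q) / (2 * \<sigma>) - norm (z - F q) / (2 * \<sigma>)\<bar>"
    unfolding sqrt_likelihood[OF assms] by (rule exp_neg_square_lipschitz)
  also have "\<dots> = \<bar>norm (y - F q) - norm (z - F q)\<bar> / (2 * \<sigma>)"
    using assms by (simp add: diff_divide_distrib[symmetric] abs_divide)
  also have "\<dots> \<le> norm (y - z) / (2 * \<sigma>)"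
    using norm_triangle_ineq3[of "y - F q" "z - F q"] assms by (intro divide_right_mono) auto
  finally show ?thesis .
qed

lemma likelihood_pos: "0 < likelihood \<sigma> F y q"
  and likelihood_le_1: "likelihood \<sigma> F y q \<le> 1"
  by (simp_all add: likelihood_def)

text \<open>A difference of squares of roots in [0, 1]: the sum of the roots contributes at most
  2.\<close>

lemma likelihood_lipschitz:
  assumes "0 < \<sigma>"
  shows "\<bar>likelihood \<sigma> F y q - likelihood \<sigma> F z q\<bar> \<le> norm (y - z) / \<sigma>"
proof -
  let ?a = "sqrt (likelihood \<sigma> F y q)" and ?b = "sqrt (likelihood \<sigma> F z q)"
  have b: "0 \<le> ?a" "?a \<le> 1" "0 \<le> ?b" "?b \<le> 1"
    using likelihood_pos[of \<sigma> F _ q] likelihood_le_1[of \<sigma> F _ q] by (simp_all add: less_imp_le)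
  have "\<bar>likelihood \<sigma> F y q - likelihood \<sigma> F z q\<bar> = \<bar>?a\<^sup>2 - ?b\<^sup>2\<bar>"
    by (simp add: likelihood_pos less_imp_le)
  also have "\<dots> = \<bar>?a + ?b\<bar> * \<bar>?a - ?b\<bar>"
    unfolding power2_eq_square square_diff_square_factored abs_mult ..
  also have "\<dots> \<le> 2 * (norm (y - z) / (2 * \<sigma>))"
  proof (intro mult_mono sqrt_likelihood_lipschitz assms)
    show "\<bar>?a + ?b\<bar> \<le> 2" using b by linarith
  qed auto
  finally show ?thesis by simp
qed

text \<open>The factor 2 in \<open>2 * (norm (F q))\<^sup>2\<close> cancels the 1/2 in the exponent;
  this is why the likelihood at 0 appears squared.\<close>

lemma likelihood_lower_bound:
  assumes "0 < \<sigma>" "norm y \<le> \<tau>"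
  shows "exp (- (\<tau> / \<sigma>)\<^sup>2) * (likelihood \<sigma> F 0 q)\<^sup>2 \<le> likelihood \<sigma> F y q"
proof -
  have "norm (y - F q) \<le> \<tau> + norm (F q)"
    using norm_triangle_ineq4[of y "F q"] assms(2) by linarith
  then have "(norm (y - F q))\<^sup>2 \<le> (\<tau> + norm (F q))\<^sup>2"
    by (intro power_mono) auto
  also have "\<dots> \<le> 2 * \<tau>\<^sup>2 + 2 * (norm (F q))\<^sup>2"
    using zero_le_power2[of "\<tau> - norm (F q)"] by (simp add: power2_diff power2_sum)
  finally have "(norm (y - F q))\<^sup>2 / \<sigma>\<^sup>2 \<le> (2 * \<tau>\<^sup>2 + 2 * (norm (F q))\<^sup>2) / \<sigma>\<^sup>2"
    by (intro divide_right_mono) auto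
  then have "- (\<tau> / \<sigma>)\<^sup>2 - (norm (F q) / \<sigma>)\<^sup>2 \<le> - (1/2) * (norm (y - F q) / \<sigma>)\<^sup>2"
    by (simp add: power_divide add_divide_distrib)
  then have "exp (- (\<tau> / \<sigma>)\<^sup>2 - (norm (F q) / \<sigma>)\<^sup>2) \<le> likelihood \<sigma> F y q"
    by (simp add: likelihood_def noise_norm_def)
  moreover have "(likelihood \<sigma> F 0 q)\<^sup>2 = exp (- (norm (F q) / \<sigma>)\<^sup>2)"
    unfolding likelihood_def noise_norm_def exp_double[symmetric] by simp
  ultimately show ?thesis by (simp add: exp_add[symmetric])
qed

lemma evidence_nonzero:
  assumes "prob_space \<mu>0" "absolutely_continuous \<mu>0 \<mu>" "is_posterior \<sigma> F \<mu>0 y \<mu>"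
  shows "evidence \<sigma> F \<mu>0 y \<noteq> 0"
proof
  interpret prob_space \<mu>0 by fact
  interpret post: prob_space \<mu> using assms(3) by (simp add: is_posterior_def)
  have sets: "sets \<mu> = sets \<mu>0" using assms(3) by (simp add: is_posterior_def)
  assume "evidence \<sigma> F \<mu>0 y = 0"
  \<comment> \<open>Division by zero yields 0, so the prescribed density becomes the zero
    function.\<close>
  then have "AE q in \<mu>0. RN_deriv \<mu>0 \<mu> q = 0"
    using assms(3) by (simp add: is_posterior_def)
  then have "(\<integral>\<^sup>+ q. RN_deriv \<mu>0 \<mu> q \<partial>\<mu>0) = 0"
    by (simp add: nn_integral_0_iff_AE)
  moreover have "emeasure (density \<mu>0 (RN_deriv \<mu>0 \<mu>)) (space \<mu>0) = (\<integral>\<^sup>+ q. RN_deriv \<mu>0 \<mu> q \<partial>\<mu>0)"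
    by (subst emeasure_density) (auto intro!: nn_integral_cong)
  ultimately have "emeasure \<mu> (space \<mu>) = 0"
    \<comment> \<open>Absolute continuity identifies \<open>\<mu>\<close> with the density of its
      Radon-Nikodym derivative, so \<open>\<mu>\<close> would have total mass 0.\<close>
    using density_RN_deriv[OF assms(2) sets] sets_eq_imp_space_eq[OF sets] by simp
  then show False using post.emeasure_space_1 by simp
qed

text \<open>
  The Bochner integral of a non-integrable function is \<open>0\<close>, so a nonzero evidence also carries the
  measurability of the likelihood.
\<close>

lemma evidence_nonzero_imp_integrable:
  "evidence \<sigma> F \<mu>0 y \<noteq> 0 \<Longrightarrow> integrable \<mu>0 (likelihood \<sigma> F y)"
  using not_integrable_integral_eq by (fastforce simp: evidence_def)

text \<open>The pointwise bound is integrated against a probability measure; the evidences are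
  assumed nonzero to have both likelihoods integrable.\<close>

lemma evidence_lipschitz:
  assumes "prob_space \<mu>0" "0 < \<sigma>" "evidence \<sigma> F \<mu>0 y \<noteq> 0" "evidence \<sigma> F \<mu>0 z \<noteq> 0"
  shows "\<bar>evidence \<sigma> F \<mu>0 y - evidence \<sigma> F \<mu>0 z\<bar> \<le> norm (y - z) / \<sigma>"
proof -
  interpret prob_space \<mu>0 by fact
  note int = assms(3,4)[THEN evidence_nonzero_imp_integrable]
  have "\<bar>evidence \<sigma> F \<mu>0 y - evidence \<sigma> F \<mu>0 z\<bar>
      = \<bar>\<integral>q. likelihood \<sigma> F y q - likelihood \<sigma> F z q \<partial>\<mu>0\<bar>"
    using int by (simp add: evidence_def)
  also have "\<dots> \<le> (\<integral>q. \<bar>likelihood \<sigma> F y q - likelihood \<sigma> F z q\<bar> \<partial>\<mu>0)"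
    by (rule integral_abs_bound)
  also have "\<dots> \<le> (\<integral>q. norm (y - z) / \<sigma> \<partial>\<mu>0)"
    using int by (intro integral_mono likelihood_lipschitz assms) auto
  finally show ?thesis by (simp add: prob_space)
qed

lemma evidence_lower_bound:
  assumes "prob_space \<mu>0" "0 < \<sigma>" "norm y \<le> \<tau>"
    and "evidence \<sigma> F \<mu>0 0 \<noteq> 0" "evidence \<sigma> F \<mu>0 y \<noteq> 0"
  shows "exp (- (\<tau> / \<sigma>)\<^sup>2) * (evidence \<sigma> F \<mu>0 0)\<^sup>2 \<le> evidence \<sigma> F \<mu>0 y"
proof -
  interpret prob_space \<mu>0 by fact
  let ?l = "likelihood \<sigma> F 0"
  note int = assms(4,5)[THEN evidence_nonzero_imp_integrable]
  have sq: "integrable \<mu>0 (\<lambda>q. (?l q)\<^sup>2)"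
    using int(1) likelihood_pos[of \<sigma> F 0] likelihood_le_1[of \<sigma> F 0]
    by (intro integrable_const_bound[where B = 1] AE_I2) (auto simp: power_le_one less_imp_le)
  \<comment> \<open>Cauchy-Schwarz against the constant 1, in the form that a variance is
    nonnegative.\<close>
  have "0 \<le> variance ?l" by (rule variance_positive)
  also have "variance ?l = (\<integral>q. (?l q)\<^sup>2 \<partial>\<mu>0) - (evidence \<sigma> F \<mu>0 0)\<^sup>2"
    using variance_eq[OF int(1) sq] by (simp add: evidence_def)
  finally have "exp (- (\<tau> / \<sigma>)\<^sup>2) * (evidence \<sigma> F \<mu>0 0)\<^sup>2
      \<le> exp (- (\<tau> / \<sigma>)\<^sup>2) * (\<integral>q. (?l q)\<^sup>2 \<partial>\<mu>0)"
    by simp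
  also have "\<dots> = (\<integral>q. exp (- (\<tau> / \<sigma>)\<^sup>2) * (?l q)\<^sup>2 \<partial>\<mu>0)"
    by simp
  also have "\<dots> \<le> evidence \<sigma> F \<mu>0 y"
    unfolding evidence_def
    using int(2) sq by (intro integral_mono likelihood_lower_bound assms) auto
  finally show ?thesis .
qed

text \<open>Rationalising gives the denominator \<open>sqrt a * sqrt b * (sqrt a + sqrt b)\<close>,
  where each root is at least \<open>sqrt c\<close>.\<close>

lemma inverse_sqrt_lipschitz:
  fixes a b c :: real
  assumes "0 < c" "c \<le> a" "c \<le> b"
  shows "\<bar>1 / sqrt a - 1 / sqrt b\<bar> \<le> \<bar>a - b\<bar> / (2 * c * sqrt c)"
proof -
  have s: "0 < sqrt c" "sqrt c \<le> sqrt a" "sqrt c \<le> sqrt b" using assms by auto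
  then have p: "0 < sqrt a" "0 < sqrt b" by linarith+
  have "\<bar>a - b\<bar> = \<bar>(sqrt b - sqrt a) * (sqrt a + sqrt b)\<bar>"
    using assms by (simp add: algebra_simps abs_minus_commute)
  also have "\<dots> = \<bar>sqrt b - sqrt a\<bar> * (sqrt a + sqrt b)"
    using p by (simp add: abs_mult)
  finally have d: "\<bar>a - b\<bar> = \<bar>sqrt b - sqrt a\<bar> * (sqrt a + sqrt b)" .
  have "1 / sqrt a - 1 / sqrt b = (sqrt b - sqrt a) / (sqrt a * sqrt b)"
    using p by (simp add: field_simps)
  then have "\<bar>1 / sqrt a - 1 / sqrt b\<bar> = \<bar>sqrt b - sqrt a\<bar> / (sqrt a * sqrt b)"
    using p by (simp add: abs_divide abs_mult)
  also have "\<dots> = \<bar>a - b\<bar> / (sqrt a * sqrt b * (sqrt a + sqrt b))"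
    using p add_pos_pos[OF p] by (simp add: d less_imp_neq[symmetric])
  also have "\<dots> \<le> \<bar>a - b\<bar> / (sqrt c * sqrt c * (sqrt c + sqrt c))"
    using s p by (intro divide_left_mono mult_mono add_mono mult_pos_pos add_pos_pos) auto
  also have "sqrt c * sqrt c * (sqrt c + sqrt c) = 2 * c * sqrt c"
    using assms(1) by simp
  finally show ?thesis .
qed

text \<open>The root densities differ by at most \<open>?B\<close> almost everywhere. In the
  constant, \<open>1 / sqrt c\<close> stems from varying the likelihood and
  \<open>1 / (c * sqrt c)\<close> from varying the normalisation.\<close>

lemma hellinger_posterior_bound:
  assumes \<mu>0: "prob_space \<mu>0" and \<sigma>: "0 < \<sigma>" and c: "0 < c"
    and post: "is_posterior \<sigma> F \<mu>0 y \<mu>" "is_posterior \<sigma> F \<mu>0 z \<nu>"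
    and Z: "c \<le> evidence \<sigma> F \<mu>0 y" "c \<le> evidence \<sigma> F \<mu>0 z"
  shows "hellinger_dist \<mu>0 \<mu> \<nu> \<le> (1 / sqrt c + 1 / (c * sqrt c)) / (2 * \<sigma>) * norm (y - z)"
    (is "_ \<le> ?B")
proof -
  interpret prob_space \<mu>0 by fact
  let ?f = "\<lambda>q. (sqrt (enn2real (RN_deriv \<mu>0 \<mu> q)) - sqrt (enn2real (RN_deriv \<mu>0 \<nu> q)))\<^sup>2"
  let ?Y = "evidence \<sigma> F \<mu>0 y" and ?Z = "evidence \<sigma> F \<mu>0 z"
  have B: "0 \<le> ?B" using c \<sigma> by simp
  have pt: "\<bar>sqrt (likelihood \<sigma> F y q / ?Y) - sqrt (likelihood \<sigma> F z q / ?Z)\<bar> \<le> ?B" for q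
  proof -
    let ?a = "sqrt (likelihood \<sigma> F y q)" and ?b = "sqrt (likelihood \<sigma> F z q)"
    have b: "0 \<le> ?b" "?b \<le> 1"
      using likelihood_pos[of \<sigma> F z q] likelihood_le_1[of \<sigma> F z q] by simp_all
    have "\<bar>?a - ?b\<bar> * (1 / sqrt ?Y) \<le> norm (y - z) / (2 * \<sigma>) * (1 / sqrt c)"
      using Z c \<sigma> by (intro mult_mono sqrt_likelihood_lipschitz divide_left_mono mult_pos_pos) auto
    moreover have "?b * \<bar>1 / sqrt ?Y - 1 / sqrt ?Z\<bar> \<le> 1 * (norm (y - z) / \<sigma> / (2 * c * sqrt c))"
    proof (intro mult_mono b)
      have "\<bar>1 / sqrt ?Y - 1 / sqrt ?Z\<bar> \<le> \<bar>?Y - ?Z\<bar> / (2 * c * sqrt c)"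
        by (rule inverse_sqrt_lipschitz[OF c Z])
      also have "\<dots> \<le> norm (y - z) / \<sigma> / (2 * c * sqrt c)"
        using c Z by (intro divide_right_mono evidence_lipschitz \<mu>0 \<sigma>) auto
      finally show "\<bar>1 / sqrt ?Y - 1 / sqrt ?Z\<bar> \<le> norm (y - z) / \<sigma> / (2 * c * sqrt c)" .
    qed auto
    \<comment> \<open>The mixed term \<open>?b / sqrt ?Y\<close> is subtracted and added, so that
      likelihood and evidence vary one at a time.\<close>
    moreover have "sqrt (likelihood \<sigma> F y q / ?Y) - sqrt (likelihood \<sigma> F z q / ?Z)
        = (?a - ?b) * (1 / sqrt ?Y) + ?b * (1 / sqrt ?Y - 1 / sqrt ?Z)"
      by (simp add: real_sqrt_divide algebra_simps)
    moreover have "\<bar>(?a - ?b) * (1 / sqrt ?Y) + ?b * (1 / sqrt ?Y - 1 / sqrt ?Z)\<bar>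
        \<le> \<bar>?a - ?b\<bar> * (1 / sqrt ?Y) + ?b * \<bar>1 / sqrt ?Y - 1 / sqrt ?Z\<bar>"
      using c Z b by (intro order_trans[OF abs_triangle_ineq]) (simp add: abs_mult)
    ultimately have "\<bar>sqrt (likelihood \<sigma> F y q / ?Y) - sqrt (likelihood \<sigma> F z q / ?Z)\<bar>
        \<le> norm (y - z) / (2 * \<sigma>) * (1 / sqrt c) + norm (y - z) / \<sigma> / (2 * c * sqrt c)"
      by linarith
    also have "\<dots> = ?B"
      using c \<sigma> by (simp add: field_simps)
    finally show ?thesis .
  qed
  have ae: "AE q in \<mu>0. ?f q \<le> ?B\<^sup>2"
  proof -
    have "AE q in \<mu>0. RN_deriv \<mu>0 \<mu> q = ennreal (likelihood \<sigma> F y q / ?Y)"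
      "AE q in \<mu>0. RN_deriv \<mu>0 \<nu> q = ennreal (likelihood \<sigma> F z q / ?Z)"
      using post by (auto simp: is_posterior_def)
    then show ?thesis
    proof eventually_elim
      case (elim q)
      \<comment> \<open>Nonnegativity lets \<open>enn2real\<close> undo
        \<open>ennreal\<close>.\<close>
      have "0 \<le> likelihood \<sigma> F y q / ?Y" "0 \<le> likelihood \<sigma> F z q / ?Z"
        using c Z by (simp_all add: less_imp_le likelihood_pos)
      then show ?case
        using power_mono[OF pt[of q] abs_ge_zero, of 2] elim by simp
    qed
  qed
  have "(\<integral>q. ?f q \<partial>\<mu>0) \<le> ?B\<^sup>2"
  \<comment> \<open>A non-integrable \<open>?f\<close> has Bochner integral 0, so the bound holds in
    that case as well.\<close>
  proof (cases "integrable \<mu>0 ?f")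
    case True
    then have "(\<integral>q. ?f q \<partial>\<mu>0) \<le> (\<integral>q. ?B\<^sup>2 \<partial>\<mu>0)"
      using ae by (intro integral_mono_AE) auto
    then show ?thesis by (simp add: prob_space)
  next
    case False
    then show ?thesis by (simp add: not_integrable_integral_eq)
  qed
  moreover have "0 \<le> ?B\<^sup>2" by simp
  ultimately have "1/2 * (\<integral>q. ?f q \<partial>\<mu>0) \<le> ?B\<^sup>2" by linarith
  then have "hellinger_dist \<mu>0 \<mu> \<nu> \<le> sqrt (?B\<^sup>2)"
    unfolding hellinger_dist_def by (rule real_sqrt_le_mono)
  then show ?thesis using B by simp
qed

theorem theorem4p1:
  fixes k \<sigma> \<alpha> :: real
    and z0 xhat d :: "real^2"
    and \<mu>0 :: "(real \<Rightarrow> real) measure"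
    and \<mu> :: "complex \<Rightarrow> (real \<Rightarrow> real) measure"
  assumes "0 < k" and "0 < \<sigma>" and "0 < \<alpha>" and "\<alpha> \<le> 1"
    and "norm xhat = 1" and "norm d = 1"
    and "gaussian_measure \<alpha> \<mu>0" and "emeasure \<mu>0 (hoelder_space \<alpha>) = 1"
    and "\<And>y. is_posterior \<sigma> (far_field k z0 xhat d) \<mu>0 y (\<mu> y)"
    and "\<And>y. absolutely_continuous \<mu>0 (\<mu> y)"
  shows "\<forall>\<tau>>0. \<exists>M>0. \<forall>y1 y2. max (norm y1) (norm y2) < \<tau> \<longrightarrow>
           hellinger_dist \<mu>0 (\<mu> y1) (\<mu> y2) \<le> M * norm (y1 - y2)"
proof (intro allI impI)
  fix \<tau> :: real
  have \<mu>0: "prob_space \<mu>0" using assms(7) by (simp add: gaussian_measure_def)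
  let ?F = "far_field k z0 xhat d"
  have Z: "evidence \<sigma> ?F \<mu>0 y \<noteq> 0" for y
    by (rule evidence_nonzero[OF \<mu>0 assms(10) assms(9)])
  \<comment> \<open>A common lower bound for the evidences of all data in the ball of radius
    \<open>\<tau>\<close>; it depends on \<open>\<tau>\<close> and the fixed data only, hence so
    does \<open>?M\<close>.\<close>
  define c where "c = exp (- (\<tau> / \<sigma>)\<^sup>2) * (evidence \<sigma> ?F \<mu>0 0)\<^sup>2"
  have c: "0 < c" using Z[of 0] by (simp add: c_def)
  have low: "c \<le> evidence \<sigma> ?F \<mu>0 y" if "norm y < \<tau>" for y
    unfolding c_def using that by (intro evidence_lower_bound \<mu>0 assms(2) Z) auto
  let ?M = "(1 / sqrt c + 1 / (c * sqrt c)) / (2 * \<sigma>)"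
  show "\<exists>M>0. \<forall>y1 y2. max (norm y1) (norm y2) < \<tau> \<longrightarrow>
           hellinger_dist \<mu>0 (\<mu> y1) (\<mu> y2) \<le> M * norm (y1 - y2)"
  proof (intro exI[of _ ?M] conjI allI impI)
    show "0 < ?M" using c assms(2) by (simp add: add_pos_pos)
    show "hellinger_dist \<mu>0 (\<mu> y1) (\<mu> y2) \<le> ?M * norm (y1 - y2)"
      if "max (norm y1) (norm y2) < \<tau>" for y1 y2
      using that by (intro hellinger_posterior_bound[where F = ?F] \<mu>0 assms(2,9) c low) auto
  qed
qed

end
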